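(* Let $(X,d)$ be a complete suprametric space, $\lambda\in[0,1)$, $n$ a positive integer, and $T:X\to X$ a mapping such that $$d(T^nx,T^ny)\le\lambda\cdot\max\big\{d(x,y),d(x,Ty),\dots,d(x,T^ny),\,d(x,Tx),d(x,T^2x),\dots,d(x,T^nx)\big\}$$ holds for all $x,y\in X$. Suppose that at least one of the following conditions holds: (i) $T$ is $k$-continuous for some $k\in\mathbb{N}$; (ii) $\mathfrak{D}(x)=d(x,Tx)$ is $T$-orbitally lower semi-continuous; (iii) $T$ obeys the condition $(C;\kappa)$ for some constant $\kappa\ge0$. Then $T$ has a unique fixed point $u\in X$, and for each $x_0\in X$, $T^qx_0\to u$ as $q\to\infty$.
   Context: A suprametric on a nonempty set $X$ is a function $d:X\times X\to[0,\infty)$ such that $d(x,y)=0$ iff $x=y$; $d(x,y)=d(y,x)$; and there is a constant $\rho\in[0,\infty)$ with $d(x,y)\le d(x,z)+d(z,y)+\rho\,d(x,z)\,d(z,y)$ for all $x,y,z\in X$. The pair $(X,d)$ is then a suprametric space. A sequence $x_n$ converges to $x$ ($x_n\to x$) if $d(x_n,x)\to0$; it is Cauchy if $d(x_n,x_p)\to0$ as $n,p\to\infty$; $(X,d)$ is complete if every Cauchy sequence converges to a point of $X$. $T^j$ denotes the $j$-fold composition of $T$ with itself, $T^0$ is the identity, $\mathbb{N}=\{1,2,3,\dots\}$, and $O(x;\infty)=\{x,Tx,T^2x,\dots\}$. $T$ is $k$-continuous if for every sequence $\{x_n\}$ in $X$ and $z\in X$, $T^{k-1}x_n\to z$ implies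 $T^kx_n\to Tz$. A function $f:X\to[0,\infty)$ is $T$-orbitally lower semi-continuous at $x$ if whenever $\{x_n\}$ is a sequence in $O(x;\infty)$ with $x_n\to z$, then $f(z)\le\liminf_{n\to\infty}f(x_n)$; it is $T$-orbitally lower semi-continuous if this holds at every $x\in X$. $T$ obeys the condition $(C;\kappa)$, with constant $\kappa\ge0$, if for every sequence $x_n\in X$ with $x_n\to w\in X$ one has $\mathfrak{D}(w)\le\kappa\cdot\limsup_{n\to\infty}\mathfrak{D}(x_n)$, where $\mathfrak{D}(x)=d(x,Tx)$. *)

theory Defs
  imports "HOL-Analysis.Analysis"
begin

text \<open>
  Spaces are given by a carrier set \<open>X\<close> and a function \<open>d\<close>; the values of \<open>d\<close> and of
  self-maps outside \<open>X\<close> are irrelevant.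
\<close>

definition suprametric_space :: "'a set \<Rightarrow> ('a \<Rightarrow> 'a \<Rightarrow> real) \<Rightarrow> bool" where
  "suprametric_space X d \<longleftrightarrow>
     X \<noteq> {} \<and>
     (\<forall>x\<in>X. \<forall>y\<in>X. 0 \<le> d x y) \<and>
     (\<forall>x\<in>X. \<forall>y\<in>X. d x y = 0 \<longleftrightarrow> x = y) \<and>
     (\<forall>x\<in>X. \<forall>y\<in>X. d x y = d y x) \<and>
     (\<exists>\<rho>\<ge>0. \<forall>x\<in>X. \<forall>y\<in>X. \<forall>z\<in>X. d x y \<le> d x z + d z y + \<rho> * d x z * d z y)"

definition sm_converges :: "('a \<Rightarrow> 'a \<Rightarrow> real) \<Rightarrow> (nat \<Rightarrow> 'a) \<Rightarrow> 'a \<Rightarrow> bool" where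
  "sm_converges d s z \<longleftrightarrow> (\<lambda>m. d (s m) z) \<longlonglongrightarrow> 0"

definition sm_Cauchy :: "('a \<Rightarrow> 'a \<Rightarrow> real) \<Rightarrow> (nat \<Rightarrow> 'a) \<Rightarrow> bool" where
  "sm_Cauchy d s \<longleftrightarrow> (\<forall>\<epsilon>>0. \<exists>N. \<forall>m\<ge>N. \<forall>p\<ge>N. d (s m) (s p) < \<epsilon>)"

definition sm_complete :: "'a set \<Rightarrow> ('a \<Rightarrow> 'a \<Rightarrow> real) \<Rightarrow> bool" where
  "sm_complete X d \<longleftrightarrow>
     (\<forall>s. (\<forall>m. s m \<in> X) \<longrightarrow> sm_Cauchy d s \<longrightarrow> (\<exists>z\<in>X. sm_converges d s z))"

definition orbit_of :: "('a \<Rightarrow> 'a) \<Rightarrow> 'a \<Rightarrow> 'a set" where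
  "orbit_of T x = range (\<lambda>j. (T ^^ j) x)"

text \<open>To be used for \<open>k \<ge> 1\<close> only, because of the truncated subtraction.\<close>

definition k_continuous ::
    "'a set \<Rightarrow> ('a \<Rightarrow> 'a \<Rightarrow> real) \<Rightarrow> ('a \<Rightarrow> 'a) \<Rightarrow> nat \<Rightarrow> bool" where
  "k_continuous X d T k \<longleftrightarrow>
     (\<forall>s z. (\<forall>m. s m \<in> X) \<longrightarrow> z \<in> X \<longrightarrow>
        sm_converges d (\<lambda>m. (T ^^ (k - 1)) (s m)) z \<longrightarrow>
        sm_converges d (\<lambda>m. (T ^^ k) (s m)) (T z))"

text \<open>
  Limits inferior and superior are taken in the extended reals, as the sequences may be unbounded.
\<close>

definition orbitally_lsc_at ::
    "'a set \<Rightarrow> ('a \<Rightarrow> 'a \<Rightarrow> real) \<Rightarrow> ('a \<Rightarrow> 'a) \<Rightarrow> ('a \<Rightarrow> real) \<Rightarrow> 'a \<Rightarrow> bool" where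
  "orbitally_lsc_at X d T f x \<longleftrightarrow>
     (\<forall>s z. (\<forall>m. s m \<in> orbit_of T x) \<longrightarrow> z \<in> X \<longrightarrow> sm_converges d s z \<longrightarrow>
        ereal (f z) \<le> liminf (\<lambda>m. ereal (f (s m))))"

definition orbitally_lsc ::
    "'a set \<Rightarrow> ('a \<Rightarrow> 'a \<Rightarrow> real) \<Rightarrow> ('a \<Rightarrow> 'a) \<Rightarrow> ('a \<Rightarrow> real) \<Rightarrow> bool" where
  "orbitally_lsc X d T f \<longleftrightarrow> (\<forall>x\<in>X. orbitally_lsc_at X d T f x)"

definition displacement :: "('a \<Rightarrow> 'a \<Rightarrow> real) \<Rightarrow> ('a \<Rightarrow> 'a) \<Rightarrow> 'a \<Rightarrow> real" where
  "displacement d T x = d x (T x)"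

text \<open>
  For \<open>\<kappa> = 0\<close> and an infinite limit superior the product below is \<open>0\<close>. Leaving that case
  unconstrained instead would not change for which \<open>T\<close> the condition holds with some \<open>\<kappa> \<ge> 0\<close>.
\<close>

definition condition_C ::
    "'a set \<Rightarrow> ('a \<Rightarrow> 'a \<Rightarrow> real) \<Rightarrow> ('a \<Rightarrow> 'a) \<Rightarrow> real \<Rightarrow> bool" where
  "condition_C X d T \<kappa> \<longleftrightarrow>
     (\<forall>s w. (\<forall>m. s m \<in> X) \<longrightarrow> w \<in> X \<longrightarrow> sm_converges d s w \<longrightarrow>
        ereal (displacement d T w)
          \<le> ereal \<kappa> * limsup (\<lambda>m. ereal (displacement d T (s m))))"

end

theory Submission
  imports Defs
begin

text \<open>
  Write \<open>x\<^sub>i = T\<^sup>i x\<close>. The right-hand side of the contraction inequality measures all distances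
  from \<open>x\<close> alone, and by symmetry of \<open>d\<close> either of the two points may play that part. Choosing the
  later of two orbit points, the inequality bounds \<open>d x\<^sub>a x\<^sub>b\<close> with \<open>n \<le> b \<le> a \<le> b + n\<close> by
  \<open>lam\<close> times a distance \<open>d x\<^bsub>a-n\<^esub> x\<^sub>c\<close> whose indices again differ by at most \<open>n\<close>, do not exceed
  \<open>a\<close>, and are at least \<open>b - n\<close>.

  The bound by \<open>a\<close> makes the distances between orbit points at most \<open>n\<close> apart bounded: a maximum over
  the indices up to \<open>m\<close> that is attained away from the start of the orbit would be at most \<open>lam\<close> times
  itself. The bound \<open>b - n\<close> then lets the inequality be iterated \<open>\<lfloor>i / n\<rfloor>\<close> times, so the steps
  \<open>d x\<^sub>i x\<^bsub>i+1\<^esub>\<close> decay geometrically (\<open>near_diagonal_decay\<close>) and have a finite sum.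
  Staying within index distance \<open>n\<close> matters: the usual bound on the diameter of the whole orbit goes
  from \<open>x\<^sub>0\<close> to \<open>x\<^sub>j\<close> through \<open>x\<^sub>n\<close>, and the quadratic term then replaces the factor \<open>lam\<close> by
  \<open>lam (1 + \<rho> d x\<^sub>0 x\<^sub>n)\<close>, which may exceed \<open>1\<close>.

  For \<open>\<rho> > 0\<close> the suprametric inequality says that \<open>1 + \<rho> d\<close> is submultiplicative along paths, that
  is, \<open>ln (1 + \<rho> d)\<close> satisfies the triangle inequality. Hence summable steps give a
  Cauchy sequence (\<open>summable_steps_imp_Cauchy\<close>), and the orbit converges to some \<open>u\<close>. Each of the
  three continuity conditions, applied to the orbit, whose displacements tend to \<open>0\<close>, forces
  \<open>T u = u\<close>. The contraction inequality makes the fixed point unique, so all orbits share their limit.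
\<close>

section \<open>Suprametric spaces\<close>

lemma suprametricD:
  assumes "suprametric_space X d" "x \<in> X" "y \<in> X"
  shows suprametric_nonneg: "0 \<le> d x y"
    and suprametric_zero_iff: "d x y = 0 \<longleftrightarrow> x = y"
    and suprametric_sym: "d x y = d y x"
  using assms by (auto simp: suprametric_space_def)

text \<open>Enlarging the constant is harmless, and a positive one allows division by it.\<close>

lemma suprametric_positive_constant:
  assumes "suprametric_space X d"
  obtains \<rho> where "\<rho> > 0"
    and "\<And>x y z. x \<in> X \<Longrightarrow> y \<in> X \<Longrightarrow> z \<in> X \<Longrightarrow> d x y \<le> d x z + d z y + \<rho> * d x z * d z y"
proof -
  obtain r where r: "r \<ge> 0"
      "\<And>x y z. x \<in> X \<Longrightarrow> y \<in> X \<Longrightarrow> z \<in> X \<Longrightarrow> d x y \<le> d x z + d z y + r * d x z * d z y"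
    using assms unfolding suprametric_space_def by metis
  have "d x y \<le> d x z + d z y + (r + 1) * d x z * d z y" if "x \<in> X" "y \<in> X" "z \<in> X" for x y z
  proof -
    have "0 \<le> d x z * d z y"
      using suprametric_nonneg[OF assms] that by simp
    with r(2)[OF that] show ?thesis by (simp add: algebra_simps)
  qed
  with r(1) that[of "r + 1"] show thesis by simp
qed

text \<open>
  The factorisation \<open>1 + \<rho> (a + b + \<rho> a b) = (1 + \<rho> a) (1 + \<rho> b)\<close> turns the suprametric inequality
  into a product over the steps of a path, and \<open>1 + t \<le> exp t\<close> turns the product into a sum.
\<close>

lemma suprametric_path_bound:
  fixes d :: "'a \<Rightarrow> 'a \<Rightarrow> real"
  assumes sm: "suprametric_space X d" and "\<rho> > 0"
    and tri: "\<And>x y z. x \<in> X \<Longrightarrow> y \<in> X \<Longrightarrow> z \<in> X \<Longrightarrow> d x y \<le> d x z + d z y + \<rho> * d x z * d z y"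
    and s: "\<And>m. s m \<in> X"
  shows "1 + \<rho> * d (s p) (s (p + r)) \<le> exp (\<rho> * (\<Sum>i<r. d (s (i + p)) (s (Suc (i + p)))))"
proof (induction r)
  case 0
  have "d (s p) (s p) = 0" using suprametric_zero_iff[OF sm s s] by simp
  then show ?case by simp
next
  case (Suc r)
  let ?a = "d (s p) (s (p + r))" and ?b = "d (s (r + p)) (s (Suc (r + p)))"
  have b: "0 \<le> ?b" by (rule suprametric_nonneg[OF sm s s])
  have "d (s p) (s (p + Suc r)) \<le> ?a + ?b + \<rho> * ?a * ?b"
    using tri[OF s s s, of p "p + Suc r" "p + r"] by (simp add: add.commute)
  then have "1 + \<rho> * d (s p) (s (p + Suc r)) \<le> 1 + \<rho> * (?a + ?b + \<rho> * ?a * ?b)"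
    using \<open>\<rho> > 0\<close> by simp
  also have "\<dots> = (1 + \<rho> * ?a) * (1 + \<rho> * ?b)" by (simp add: algebra_simps)
  also have "\<dots> \<le> exp (\<rho> * (\<Sum>i<r. d (s (i + p)) (s (Suc (i + p))))) * exp (\<rho> * ?b)"
    using Suc.IH b \<open>\<rho> > 0\<close> by (intro mult_mono) auto
  also have "\<dots> = exp (\<rho> * (\<Sum>i<Suc r. d (s (i + p)) (s (Suc (i + p)))))"
    by (simp add: exp_add[symmetric] algebra_simps)
  finally show ?case .
qed

lemma summable_steps_imp_Cauchy:
  fixes d :: "'a \<Rightarrow> 'a \<Rightarrow> real"
  assumes sm: "suprametric_space X d" and s: "\<And>m. s m \<in> X"
    and summ: "summable (\<lambda>i. d (s i) (s (Suc i)))"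
  shows "sm_Cauchy d s"
  unfolding sm_Cauchy_def
proof (intro allI impI)
  fix \<epsilon> :: real assume "\<epsilon> > 0"
  obtain \<rho> where \<rho>: "\<rho> > 0"
      "\<And>x y z. x \<in> X \<Longrightarrow> y \<in> X \<Longrightarrow> z \<in> X \<Longrightarrow> d x y \<le> d x z + d z y + \<rho> * d x z * d z y"
    using suprametric_positive_constant[OF sm] by blast
  have nonneg: "0 \<le> d (s i) (s j)" for i j
    by (rule suprametric_nonneg[OF sm s s])
  \<comment> \<open>The threshold solves \<open>exp (\<rho> t) = 1 + \<rho> \<epsilon>\<close> for \<open>t\<close>.\<close>
  have "0 < ln (1 + \<rho> * \<epsilon>) / \<rho>" using \<rho>(1) \<open>\<epsilon> > 0\<close> by (intro divide_pos_pos ln_gt_zero) auto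
  from suminf_exist_split[OF this summ]
  obtain N where N: "\<And>p. p \<ge> N \<Longrightarrow> norm (\<Sum>i. d (s (i + p)) (s (Suc (i + p)))) < ln (1 + \<rho> * \<epsilon>) / \<rho>"
    by auto
  have forward: "d (s p) (s (p + r)) < \<epsilon>" if "p \<ge> N" for p r
  proof -
    let ?e = "\<lambda>i. d (s (i + p)) (s (Suc (i + p)))"
    have "summable ?e" using summable_ignore_initial_segment[OF summ, of p] by simp
    then have "(\<Sum>i<r. ?e i) \<le> (\<Sum>i. ?e i)" by (intro sum_le_suminf) (auto simp: nonneg)
    also have "\<dots> < ln (1 + \<rho> * \<epsilon>) / \<rho>" using N[OF that] by simp
    finally have "\<rho> * (\<Sum>i<r. ?e i) < ln (1 + \<rho> * \<epsilon>)" using \<rho>(1) by (simp add: field_simps)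
    moreover have "0 < 1 + \<rho> * \<epsilon>" using \<rho>(1) \<open>\<epsilon> > 0\<close> by (simp add: add_pos_pos)
    ultimately have "exp (\<rho> * (\<Sum>i<r. ?e i)) < 1 + \<rho> * \<epsilon>"
      by (metis exp_less_mono exp_ln)
    with suprametric_path_bound[where s = s and p = p and r = r, OF sm \<rho> s]
    have "\<rho> * d (s p) (s (p + r)) < \<rho> * \<epsilon>" by simp
    then show ?thesis using \<rho>(1) by simp
  qed
  have sym: "d (s i) (s j) = d (s j) (s i)" for i j
    by (rule suprametric_sym[OF sm s s])
  have "d (s m) (s p) < \<epsilon>" if "m \<ge> N" "p \<ge> N" for m p
    using forward[of m "p - m"] forward[of p "m - p"] sym[of m p] that by (cases "m \<le> p") auto
  then show "\<exists>N. \<forall>m\<ge>N. \<forall>p\<ge>N. d (s m) (s p) < \<epsilon>" by blast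
qed

lemma sm_converges_unique:
  fixes d :: "'a \<Rightarrow> 'a \<Rightarrow> real"
  assumes sm: "suprametric_space X d" and s: "\<And>m. s m \<in> X" and "u \<in> X" "v \<in> X"
    and u: "sm_converges d s u" and v: "sm_converges d s v"
  shows "u = v"
proof -
  obtain \<rho> where \<rho>: "\<rho> > 0"
      "\<And>x y z. x \<in> X \<Longrightarrow> y \<in> X \<Longrightarrow> z \<in> X \<Longrightarrow> d x y \<le> d x z + d z y + \<rho> * d x z * d z y"
    using suprametric_positive_constant[OF sm] by blast
  have sym: "d u (s m) = d (s m) u" for m
    by (rule suprametric_sym[OF sm \<open>u \<in> X\<close> s])
  have "(\<lambda>m. d (s m) u + d (s m) v + \<rho> * d (s m) u * d (s m) v) \<longlonglongrightarrow> 0 + 0 + \<rho> * 0 * 0"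
    using u v unfolding sm_converges_def by (intro tendsto_intros)
  moreover have "d u v \<le> d (s m) u + d (s m) v + \<rho> * d (s m) u * d (s m) v" for m
    using \<rho>(2)[OF \<open>u \<in> X\<close> \<open>v \<in> X\<close> s, of m] by (simp add: sym)
  ultimately have "d u v \<le> 0"
    using LIMSEQ_le_const[of _ 0 "d u v"] by simp
  then show ?thesis
    using suprametric_nonneg[OF sm \<open>u \<in> X\<close> \<open>v \<in> X\<close>] suprametric_zero_iff[OF sm \<open>u \<in> X\<close> \<open>v \<in> X\<close>]
    by simp
qed

section \<open>Geometric decay near the diagonal\<close>

text \<open>
  Here \<open>D i j\<close> stands for \<open>d (T\<^sup>i x) (T\<^sup>j x)\<close>, and the hypothesis \<open>step\<close> is what the contraction
  inequality says about orbit points. A step may keep the larger index, and even the sum of the two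
  indices, so boundedness is not reached by induction on them; it comes from looking at a largest
  entry.
\<close>

lemma near_diagonal_decay:
  fixes D :: "nat \<Rightarrow> nat \<Rightarrow> real" and lam :: real and n :: nat
  assumes sym: "\<And>i j. D i j = D j i" and nonneg: "\<And>i j. 0 \<le> D i j"
    and lam: "0 \<le> lam" "lam < 1"
    and step: "\<And>i j. \<exists>c. c \<in> {j..j + n} \<union> {i..i + n} \<and> D (i + n) (j + n) \<le> lam * D i c"
  obtains F where "F \<ge> 0"
    and "\<And>q a b. q * n \<le> a \<Longrightarrow> q * n \<le> b \<Longrightarrow> a \<le> b + n \<Longrightarrow> b \<le> a + n \<Longrightarrow> D a b \<le> lam ^ q * F"
proof -
  define near where "near a b \<longleftrightarrow> a \<le> b + n \<and> b \<le> a + n" for a b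
  have descend: "\<exists>i j. near i j \<and> i \<le> max a b \<and> j \<le> max a b \<and> min a b \<le> i + n \<and> min a b \<le> j + n
      \<and> D a b \<le> lam * D i j"
    if "near a b" "n \<le> a" "n \<le> b" for a b
  proof -
    \<comment> \<open>The larger index is the one that drops by \<open>n\<close>; this is what keeps the new pair near the diagonal.\<close>
    have ordered: "\<exists>i j. near i j \<and> i \<le> a' \<and> j \<le> a' \<and> b' \<le> i + n \<and> b' \<le> j + n
        \<and> D a' b' \<le> lam * D i j"
      if "near a' b'" "n \<le> b'" "b' \<le> a'" for a' b'
    proof -
      obtain c where c: "c \<in> {b' - n..b' - n + n} \<union> {a' - n..a' - n + n}"
          "D (a' - n + n) (b' - n + n) \<le> lam * D (a' - n) c"
        using step[of "b' - n" "a' - n"] by blast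
      show ?thesis
        using that c unfolding near_def
        by (intro exI[of _ "a' - n"] exI[of _ c]) auto
    qed
    show ?thesis
      using ordered[of a b] ordered[of b a] that sym[of a b]
      by (cases "b \<le> a") (auto simp: near_def max_def min_def)
  qed
  \<comment> \<open>If one index of a pair near the diagonal is below \<open>n\<close>, the other is below \<open>2 n\<close>.\<close>
  define F where "F = Max ((\<lambda>(a, b). D a b) ` ({..2 * n} \<times> {..2 * n}))"
  have F_upper: "D a b \<le> F" if "a \<le> 2 * n" "b \<le> 2 * n" for a b
    unfolding F_def using that by (intro Max_ge) force+
  have "0 \<le> F" using F_upper[of 0 0] nonneg[of 0 0] by simp
  have bounded: "D a b \<le> F" if "near a b" for a b
  proof -
    let ?S = "{(i, j). near i j \<and> i \<le> max a b \<and> j \<le> max a b}"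
    let ?M = "Max ((\<lambda>(i, j). D i j) ` ?S)"
    have fin: "finite ?S"
      by (rule finite_subset[of _ "{..max a b} \<times> {..max a b}"]) auto
    have "(a, b) \<in> ?S" using that by simp
    then have upper: "D a b \<le> ?M" using fin by (intro Max_ge) force+
    have "?M \<in> (\<lambda>(i, j). D i j) ` ?S"
      using fin \<open>(a, b) \<in> ?S\<close> by (intro Max_in) blast+
    then obtain i j where ij: "(i, j) \<in> ?S" "?M = D i j" by auto
    have "D i j \<le> F"
    proof (cases "n \<le> i \<and> n \<le> j")
      case True
      then obtain i' j' where ij': "near i' j'" "i' \<le> max i j" "j' \<le> max i j"
          "D i j \<le> lam * D i' j'"
        using descend[of i j] ij(1) by blast
      then have "(i', j') \<in> ?S" using ij(1) by auto
      then have "D i' j' \<le> ?M" using fin by (intro Max_ge) force+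
      then have "lam * D i' j' \<le> lam * D i j" using ij(2) lam by (intro mult_left_mono) simp_all
      then have "D i j \<le> lam * D i j" using ij'(4) by simp
      then have "(1 - lam) * D i j \<le> 0" by (simp add: algebra_simps)
      then have "D i j \<le> 0" using lam by (simp add: mult_le_0_iff)
      then show ?thesis using \<open>0 \<le> F\<close> by simp
    next
      case False
      then show ?thesis using ij(1) by (intro F_upper) (auto simp: near_def)
    qed
    with upper ij(2) show ?thesis by simp
  qed
  have decay: "D a b \<le> lam ^ q * F" if "q * n \<le> a" "q * n \<le> b" "near a b" for q a b
    using that
  proof (induction q arbitrary: a b)
    case 0
    then show ?case using bounded by simp
  next
    case (Suc q)
    obtain i j where ij: "near i j" "min a b \<le> i + n" "min a b \<le> j + n" "D a b \<le> lam * D i j"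
      using descend[of a b] Suc.prems by auto
    have "q * n \<le> i" "q * n \<le> j" using ij(2,3) Suc.prems(1,2) by auto
    then have "D i j \<le> lam ^ q * F" using Suc.IH ij(1) by blast
    then have "lam * D i j \<le> lam * (lam ^ q * F)" using lam(1) by (rule mult_left_mono)
    then show ?case using ij(4) by simp
  qed
  show thesis by (rule that[OF \<open>0 \<le> F\<close> decay]) (auto simp: near_def)
qed

lemma summable_blockwise_geometric:
  fixes e :: "nat \<Rightarrow> real"
  assumes "n \<ge> 1" "0 \<le> lam" "lam < 1" "F \<ge> 0" and nonneg: "\<And>i. 0 \<le> e i"
    and bound: "\<And>q i. q * n \<le> i \<Longrightarrow> e i \<le> lam ^ q * F"
  shows "summable e"
proof (rule summableI_nonneg_bounded[OF nonneg])
  fix N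
  have "(\<Sum>i<N. e i) \<le> (\<Sum>i<N * n. e i)"
    using \<open>n \<ge> 1\<close> nonneg by (intro sum_mono2) auto
  also have "\<dots> = (\<Sum>q<N. sum e {q * n..<q * n + n})" by (rule sum.nat_group[symmetric])
  also have "\<dots> \<le> (\<Sum>q<N. \<Sum>i\<in>{q * n..<q * n + n}. lam ^ q * F)"
    by (intro sum_mono bound) simp
  also have "\<dots> = (\<Sum>q<N. lam ^ q) * (real n * F)"
    by (simp add: sum_distrib_right sum_distrib_left algebra_simps)
  also have "\<dots> \<le> (\<Sum>q. lam ^ q) * (real n * F)"
    using assms by (intro mult_right_mono sum_le_suminf summable_geometric) auto
  finally show "(\<Sum>i<N. e i) \<le> (\<Sum>q. lam ^ q) * (real n * F)" .
qed

section \<open>Orbits and fixed points\<close>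

lemma orbit_in_carrier:
  assumes "T \<in> X \<rightarrow> X" "x \<in> X"
  shows "(T ^^ i) x \<in> X"
  using assms by (induction i) auto

lemma orbit_steps_summable:
  fixes d :: "'a \<Rightarrow> 'a \<Rightarrow> real"
  assumes sm: "suprametric_space X d"
    and lam: "0 \<le> lam" "lam < 1" and "n \<ge> 1" and T: "T \<in> X \<rightarrow> X"
    and contr: "\<forall>x\<in>X. \<forall>y\<in>X. d ((T ^^ n) x) ((T ^^ n) y) \<le>
           lam * Max ({d x y} \<union> {d x ((T ^^ i) y) | i. i \<in> {1..n}} \<union> {d x ((T ^^ i) x) | i. i \<in> {1..n}})"
    and "x \<in> X"
  shows "summable (\<lambda>i. d ((T ^^ i) x) ((T ^^ Suc i) x))"
proof -
  note orb = orbit_in_carrier[OF T \<open>x \<in> X\<close>]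
  define D where "D i j = d ((T ^^ i) x) ((T ^^ j) x)" for i j
  have sym: "D i j = D j i" and nonneg: "0 \<le> D i j" for i j
    unfolding D_def by (rule suprametric_sym[OF sm orb orb], rule suprametric_nonneg[OF sm orb orb])
  have step: "\<exists>c. c \<in> {j..j + n} \<union> {i..i + n} \<and> D (i + n) (j + n) \<le> lam * D i c" for i j
  proof -
    let ?y = "(T ^^ i) x" and ?z = "(T ^^ j) x"
    let ?S = "{d ?y ?z} \<union> {d ?y ((T ^^ k) ?z) | k. k \<in> {1..n}} \<union> {d ?y ((T ^^ k) ?y) | k. k \<in> {1..n}}"
    have le: "D (i + n) (j + n) \<le> lam * Max ?S"
      using contr orb[of i] orb[of j] unfolding D_def
      by (simp add: add.commute[of _ n] funpow_add)
    have pow: "(T ^^ k) ((T ^^ m) x) = (T ^^ (m + k)) x" for k m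
      by (simp add: add.commute[of m] funpow_add)
    have "Max ?S \<in> ?S" by (intro Max_in) auto
    then consider "Max ?S = D i j" | k where "k \<in> {1..n}" "Max ?S = D i (j + k)"
      | k where "k \<in> {1..n}" "Max ?S = D i (i + k)"
      unfolding D_def pow by blast
    then have "\<exists>c. c \<in> {j..j + n} \<union> {i..i + n} \<and> Max ?S = D i c"
      by cases (auto intro: exI[of _ j] exI[of _ "j + k" for k] exI[of _ "i + k" for k])
    with le show ?thesis by auto
  qed
  obtain F where F: "F \<ge> 0"
    "\<And>q a b. q * n \<le> a \<Longrightarrow> q * n \<le> b \<Longrightarrow> a \<le> b + n \<Longrightarrow> b \<le> a + n \<Longrightarrow> D a b \<le> lam ^ q * F"
    using near_diagonal_decay[OF sym nonneg lam step] by blast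
  have "summable (\<lambda>i. D i (Suc i))"
    using F \<open>n \<ge> 1\<close> nonneg lam by (intro summable_blockwise_geometric[of n lam F]) auto
  then show ?thesis unfolding D_def .
qed

text \<open>
  This is the only place where the three continuity conditions enter. For the first, the images of
  the orbit under \<open>T\<^sup>k\<^sup>-\<^sup>1\<close> and \<open>T\<^sup>k\<close> are both tails of it, so they tend to \<open>u\<close>, while
  \<open>k\<close>-continuity sends the second to \<open>T u\<close>. The other two bound the displacement of \<open>u\<close> by a multiple
  of the limit of the displacements.
\<close>

lemma orbit_limit_is_fixed_point:
  fixes d :: "'a \<Rightarrow> 'a \<Rightarrow> real"
  assumes sm: "suprametric_space X d" and T: "T \<in> X \<rightarrow> X" and "x \<in> X" "u \<in> X"
    and lim: "sm_converges d (\<lambda>q. (T ^^ q) x) u"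
    and disp: "(\<lambda>q. displacement d T ((T ^^ q) x)) \<longlonglongrightarrow> 0"
    and cond: "(\<exists>k\<ge>1. k_continuous X d T k) \<or>
         orbitally_lsc X d T (displacement d T) \<or>
         (\<exists>\<kappa>\<ge>0. condition_C X d T \<kappa>)"
  shows "T u = u"
proof -
  note orb = orbit_in_carrier[OF T \<open>x \<in> X\<close>]
  have Tu: "T u \<in> X" using T \<open>u \<in> X\<close> by auto
  have zero: "T u = u" if "displacement d T u \<le> 0"
    using that suprametric_nonneg[OF sm \<open>u \<in> X\<close> Tu] suprametric_zero_iff[OF sm \<open>u \<in> X\<close> Tu]
    by (simp add: displacement_def)
  have disp': "(\<lambda>q. ereal (displacement d T ((T ^^ q) x))) \<longlonglongrightarrow> ereal 0"
    using disp by simp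
  from cond show ?thesis
  proof (elim disjE exE conjE)
    fix k assume k: "k_continuous X d T k"
    have tail: "sm_converges d (\<lambda>q. (T ^^ m) ((T ^^ q) x)) u" for m
      using LIMSEQ_ignore_initial_segment[OF lim[unfolded sm_converges_def], of m]
      by (simp add: sm_converges_def add.commute[of _ m] funpow_add)
    have "sm_converges d (\<lambda>q. (T ^^ k) ((T ^^ q) x)) (T u)"
      using k orb \<open>u \<in> X\<close> tail[of "k - 1"] unfolding k_continuous_def
      by (auto dest!: spec[of _ "\<lambda>q. (T ^^ q) x"])
    then show ?thesis
      using sm_converges_unique[OF sm _ Tu \<open>u \<in> X\<close> _ tail[of k]] orbit_in_carrier[OF T orb] by blast
  next
    assume "orbitally_lsc X d T (displacement d T)"
    then have "ereal (displacement d T u) \<le> liminf (\<lambda>q. ereal (displacement d T ((T ^^ q) x)))"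
      using \<open>x \<in> X\<close> \<open>u \<in> X\<close> lim unfolding orbitally_lsc_def orbitally_lsc_at_def orbit_of_def
      by (auto dest!: bspec[of _ _ x] spec[of _ "\<lambda>q. (T ^^ q) x"])
    also have "\<dots> = ereal 0" by (rule lim_imp_Liminf[OF trivial_limit_sequentially disp'])
    finally show ?thesis using zero by simp
  next
    fix \<kappa> assume "condition_C X d T \<kappa>"
    then have "ereal (displacement d T u) \<le> ereal \<kappa> * limsup (\<lambda>q. ereal (displacement d T ((T ^^ q) x)))"
      using orb \<open>u \<in> X\<close> lim unfolding condition_C_def
      by (auto dest!: spec[of _ "\<lambda>q. (T ^^ q) x"])
    also have "limsup (\<lambda>q. ereal (displacement d T ((T ^^ q) x))) = ereal 0"
      by (rule lim_imp_Limsup[OF trivial_limit_sequentially disp'])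
    finally show ?thesis using zero by simp
  qed
qed

text \<open>At two fixed points every distance in the maximum is either \<open>d u v\<close> or \<open>d u u = 0\<close>.\<close>

lemma contraction_fixed_point_unique:
  fixes d :: "'a \<Rightarrow> 'a \<Rightarrow> real"
  assumes sm: "suprametric_space X d" and lam: "0 \<le> lam" "lam < 1"
    and contr: "\<forall>x\<in>X. \<forall>y\<in>X. d ((T ^^ n) x) ((T ^^ n) y) \<le>
           lam * Max ({d x y} \<union> {d x ((T ^^ i) y) | i. i \<in> {1..n}} \<union> {d x ((T ^^ i) x) | i. i \<in> {1..n}})"
    and "u \<in> X" "v \<in> X" "T u = u" "T v = v"
  shows "u = v"
proof -
  have fix_pow: "(T ^^ i) u = u" "(T ^^ i) v = v" for i
    using \<open>T u = u\<close> \<open>T v = v\<close> by (induction i) auto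
  have facts: "0 \<le> d u v" "d u u = 0" "d u v = 0 \<longleftrightarrow> u = v"
    using suprametricD[OF sm \<open>u \<in> X\<close> \<open>v \<in> X\<close>] suprametric_zero_iff[OF sm \<open>u \<in> X\<close> \<open>u \<in> X\<close>] by auto
  let ?S = "{d u v} \<union> {d u ((T ^^ i) v) | i. i \<in> {1..n}} \<union> {d u ((T ^^ i) u) | i. i \<in> {1..n}}"
  have "Max ?S \<le> d u v"
    using facts by (intro Max.boundedI) (auto simp: fix_pow)
  then have "lam * Max ?S \<le> lam * d u v" using lam(1) by (rule mult_left_mono)
  moreover have "d u v \<le> lam * Max ?S"
    using contr[rule_format, OF \<open>u \<in> X\<close> \<open>v \<in> X\<close>] by (simp only: fix_pow)
  ultimately have "(1 - lam) * d u v \<le> 0" by (simp add: algebra_simps)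
  then have "d u v \<le> 0" using lam(2) by (simp add: mult_le_0_iff)
  with facts show ?thesis by simp
qed

theorem theorem3p3:
  fixes X :: "'a set" and d :: "'a \<Rightarrow> 'a \<Rightarrow> real" and T :: "'a \<Rightarrow> 'a"
    and lam :: real and n :: nat
  assumes "suprametric_space X d"
    and "sm_complete X d"
    and "0 \<le> lam" and "lam < 1"
    and "n \<ge> 1"
    and "T \<in> X \<rightarrow> X"
    and "\<forall>x\<in>X. \<forall>y\<in>X. d ((T ^^ n) x) ((T ^^ n) y) \<le>
           lam * Max ({d x y} \<union> {d x ((T ^^ i) y) | i. i \<in> {1..n}} \<union> {d x ((T ^^ i) x) | i. i \<in> {1..n}})"
    and "(\<exists>k\<ge>1. k_continuous X d T k) \<or>
         orbitally_lsc X d T (displacement d T) \<or>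
         (\<exists>\<kappa>\<ge>0. condition_C X d T \<kappa>)"
  shows "\<exists>u\<in>X. T u = u \<and> (\<forall>v\<in>X. T v = v \<longrightarrow> v = u) \<and>
           (\<forall>x0\<in>X. sm_converges d (\<lambda>q. (T ^^ q) x0) u)"
proof -
  have orbit_limit: "\<exists>u\<in>X. T u = u \<and> sm_converges d (\<lambda>q. (T ^^ q) x) u" if "x \<in> X" for x
  proof -
    note orb = orbit_in_carrier[OF assms(6) that]
    have summ: "summable (\<lambda>i. d ((T ^^ i) x) ((T ^^ Suc i) x))"
      by (rule orbit_steps_summable[OF assms(1,3,4,5,6,7) that])
    have cauchy: "sm_Cauchy d (\<lambda>q. (T ^^ q) x)"
      by (rule summable_steps_imp_Cauchy[OF assms(1) orb summ])
    obtain u where u: "u \<in> X" "sm_converges d (\<lambda>q. (T ^^ q) x) u"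
      using assms(2)[unfolded sm_complete_def, rule_format, OF orb cauchy] by blast
    have "(\<lambda>q. displacement d T ((T ^^ q) x)) \<longlonglongrightarrow> 0"
      using summable_LIMSEQ_zero[OF summ] by (simp add: displacement_def)
    then have "T u = u"
      by (rule orbit_limit_is_fixed_point[OF assms(1,6) that u _ assms(8)])
    with u show ?thesis by (intro bexI[of _ u] conjI)
  qed
  note unique = contraction_fixed_point_unique[OF assms(1,3,4,7)]
  obtain x where "x \<in> X" using assms(1) by (auto simp: suprametric_space_def)
  then obtain u where u: "u \<in> X" "T u = u" using orbit_limit by blast
  have "sm_converges d (\<lambda>q. (T ^^ q) x0) u" if x0: "x0 \<in> X" for x0
  proof -
    obtain v where v: "v \<in> X" "T v = v" "sm_converges d (\<lambda>q. (T ^^ q) x0) v"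
      using orbit_limit[OF x0] by (elim bexE conjE)
    from v(3) show ?thesis unfolding unique[OF v(1) u(1) v(2) u(2)] .
  qed
  then show ?thesis
    using u unique[OF _ u(1) _ u(2)] by (intro bexI[of _ u] conjI ballI impI)
qed

end
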